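(* Let $\mathbf M = \langle Q \cup \Sigma \cup \{0\}; \cdot\rangle$ be a finite automatic algebra and let $a \in \Sigma$. If $a$ does not act as whiskery cycles, then $\mathbf M$ is inherently non-dualizable.
   Context: **Automatic algebras.** An automatic algebra is an algebra with a single binary operation $\mathbf M = \langle Q \cup \Sigma \cup \{0\}; \cdot\rangle$, where $Q$ (states) and $\Sigma$ (letters) are disjoint sets and $0 \notin Q\cup\Sigma$, that encodes a partial (deterministic) automaton: each letter $a \in \Sigma$ acts as a partial map $Q \to Q$; for $q,r\in Q$ and $a \in \Sigma$ we have $q\cdot a = r$ iff $a$ sends $q$ to $r$; all other products are $0$. Products are bracketed from the left: $uv_1v_2\cdots v_n := (\cdots((u\cdot v_1)\cdot v_2)\cdots)\cdot v_n$, and $u\cdot v^n$ (or $uv^n$) means $uvv\cdots v$ with $n$ occurrences of $v$. $\mathbb N=\{1,2,3,\dots\}$. **Whiskery cycles.** A letter $a \in \Sigma$ acts as whiskery cycles if for all $q \in Q$ there exists $n \in \mathbb N$ such that $qa = qa^{n+1}$. **Dualizability.** Let $\mathbf M$ be a finite algebra with universe $M$. A $k$-ary relation on $M$ ($k\ge 1$) is compatible with $\mathbf M$ if it is a subuniverse of $\mathbf M^k$. For $\mathbf A \in \mathbb{ISP}(\mathbf M)$ (isomorphic copies of subalgebras of powers of $\mathbf M$), view $\hom(\mathbf A,\mathbf M)\subseteq M^A$ with the subspace topology of the product topology ($M$ discrete), and with relations on $M$ interpreted pointwise. A map $f\colon \hom(\mathbf A,\mathbf M)\to M$ is an evaluation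 if there is $a\in A$ with $f(x)=x(a)$ for all $x$. The algebra $\mathbf M$ is dualizable if, for every $\mathbf A\in\mathbb{ISP}(\mathbf M)$, every continuous map $f\colon\hom(\mathbf A,\mathbf M)\to M$ that preserves all finitary compatible relations on $\mathbf M$ is an evaluation. A finite algebra $\mathbf M$ is inherently non-dualizable if every finite algebra (of the same type) that has $\mathbf M$ as a subalgebra is non-dualizable. *)

theory Defs
  imports "HOL-Analysis.Analysis" "HOL-Library.Infinite_Typeclass"
begin

text \<open>
  Algebras with one binary operation. Only the values of \<open>bop\<close> on \<open>universe\<close> are meaningful.
  Universes of algebras are nonempty; subuniverses may be empty.
\<close>

record 'a alg =
  universe :: "'a set"
  bop :: "'a \<Rightarrow> 'a \<Rightarrow> 'a"

definition subuniverse :: "'a alg \<Rightarrow> 'a set \<Rightarrow> bool" where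
  "subuniverse M S \<longleftrightarrow> S \<subseteq> universe M \<and> (\<forall>x\<in>S. \<forall>y\<in>S. bop M x y \<in> S)"

definition is_algebra :: "'a alg \<Rightarrow> bool" where
  "is_algebra M \<longleftrightarrow> universe M \<noteq> {} \<and> subuniverse M (universe M)"

definition subalgebra :: "'a alg \<Rightarrow> 'a alg \<Rightarrow> bool" where
  "subalgebra B M \<longleftrightarrow> universe B \<noteq> {} \<and> subuniverse M (universe B) \<and>
     (\<forall>x\<in>universe B. \<forall>y\<in>universe B. bop B x y = bop M x y)"

definition power_alg :: "'a alg \<Rightarrow> 'i set \<Rightarrow> ('i \<Rightarrow> 'a) alg" where
  "power_alg M I = \<lparr>universe = I \<rightarrow>\<^sub>E universe M, bop = (\<lambda>x y. \<lambda>i\<in>I. bop M (x i) (y i))\<rparr>"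

definition homs :: "'b alg \<Rightarrow> 'a alg \<Rightarrow> ('b \<Rightarrow> 'a) set" where
  "homs A M = {h \<in> universe A \<rightarrow>\<^sub>E universe M.
     \<forall>x\<in>universe A. \<forall>y\<in>universe A. h (bop A x y) = bop M (h x) (h y)}"

definition isomorphic :: "'b alg \<Rightarrow> 'c alg \<Rightarrow> bool" where
  "isomorphic A B \<longleftrightarrow> (\<exists>h\<in>homs A B. bij_betw h (universe A) (universe B))"

text \<open>
  The members of ISP(M) whose universe is a set over the type \<open>'b\<close>. Powers are indexed by sets
  over \<open>'b \<Rightarrow> 'a\<close>; lemma \<open>ISP_I\<close> below shows that other index types give no further algebras.
\<close>

definition ISP :: "'a alg \<Rightarrow> 'b alg set" where
  "ISP M = {A. is_algebra A \<and>
     (\<exists>(I :: ('b \<Rightarrow> 'a) set) B. subalgebra B (power_alg M I) \<and> isomorphic A B)}"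

definition hom_topology :: "'b alg \<Rightarrow> 'a alg \<Rightarrow> ('b \<Rightarrow> 'a) topology" where
  "hom_topology A M =
     subtopology (product_topology (\<lambda>_. discrete_topology (universe M)) (universe A)) (homs A M)"

definition compatible_relation :: "'a alg \<Rightarrow> nat \<Rightarrow> (nat \<Rightarrow> 'a) set \<Rightarrow> bool" where
  "compatible_relation M k R \<longleftrightarrow> k \<ge> 1 \<and> subuniverse (power_alg M {..<k}) R"

definition preserves ::
  "'b alg \<Rightarrow> 'a alg \<Rightarrow> (('b \<Rightarrow> 'a) \<Rightarrow> 'a) \<Rightarrow> nat \<Rightarrow> (nat \<Rightarrow> 'a) set \<Rightarrow> bool" where
  "preserves A M f k R \<longleftrightarrow>
     (\<forall>x. (\<forall>i<k. x i \<in> homs A M) \<and> (\<forall>a\<in>universe A. (\<lambda>i\<in>{..<k}. x i a) \<in> R)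
        \<longrightarrow> (\<lambda>i\<in>{..<k}. f (x i)) \<in> R)"

definition is_evaluation :: "'b alg \<Rightarrow> 'a alg \<Rightarrow> (('b \<Rightarrow> 'a) \<Rightarrow> 'a) \<Rightarrow> bool" where
  "is_evaluation A M f \<longleftrightarrow> (\<exists>a\<in>universe A. \<forall>x\<in>homs A M. f x = x a)"

text \<open>
  HOL cannot quantify over all algebras of ISP(M), so the type \<open>'b\<close> over which they are taken is
  a parameter. It must be infinite: maps on \<open>homs A M\<close> that preserve all compatible relations are
  always evaluations when \<open>A\<close> and \<open>M\<close> are finite. For finite \<open>M\<close> the choice of the infinite type
  does not matter, because by compactness of the spaces \<open>homs A M\<close> a failure of dualizability is
  always witnessed by some countable \<open>A\<close>.
\<close>

definition dualizable :: "'b::infinite itself \<Rightarrow> 'a alg \<Rightarrow> bool" where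
  "dualizable _ M \<longleftrightarrow>
     (\<forall>A\<in>(ISP M :: 'b alg set). \<forall>f.
        continuous_map (hom_topology A M) (discrete_topology (universe M)) f \<and>
        (\<forall>k R. compatible_relation M k R \<longrightarrow> preserves A M f k R)
        \<longrightarrow> is_evaluation A M f)"

text \<open>
  The type \<open>'a\<close> is infinite so that every finite algebra extending \<open>M\<close> has, up to an isomorphism
  fixing \<open>M\<close>, its universe in \<open>'a\<close>.
\<close>

definition inherently_nondualizable :: "'b::infinite itself \<Rightarrow> 'a::infinite alg \<Rightarrow> bool" where
  "inherently_nondualizable T M \<longleftrightarrow>
     (\<forall>N. is_algebra N \<and> finite (universe N) \<and> subalgebra M N \<longrightarrow> \<not> dualizable T N)"

text \<open>
  States \<open>Q\<close>, letters \<open>S\<close>, zero element \<open>z\<close>; the letter \<open>a\<close> acts as the partial map \<open>\<delta> a\<close>.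
\<close>

definition partial_automaton ::
  "'a set \<Rightarrow> 'a set \<Rightarrow> 'a \<Rightarrow> ('a \<Rightarrow> 'a \<rightharpoonup> 'a) \<Rightarrow> bool" where
  "partial_automaton Q S z \<delta> \<longleftrightarrow> Q \<inter> S = {} \<and> z \<notin> Q \<union> S \<and>
     (\<forall>a\<in>S. dom (\<delta> a) \<subseteq> Q \<and> ran (\<delta> a) \<subseteq> Q)"

definition automatic_algebra ::
  "'a set \<Rightarrow> 'a set \<Rightarrow> 'a \<Rightarrow> ('a \<Rightarrow> 'a \<rightharpoonup> 'a) \<Rightarrow> 'a alg" where
  "automatic_algebra Q S z \<delta> =
     \<lparr>universe = Q \<union> S \<union> {z},
      bop = (\<lambda>x y. if x \<in> Q \<and> y \<in> S
                    then (case \<delta> y x of Some r \<Rightarrow> r | None \<Rightarrow> z) else z)\<rparr>"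

definition right_power :: "'a alg \<Rightarrow> 'a \<Rightarrow> 'a \<Rightarrow> nat \<Rightarrow> 'a" where
  \<comment> \<open>\<open>u v v \<dots> v\<close> with \<open>n\<close> occurrences of \<open>v\<close>, bracketed from the left\<close>
  "right_power M u v n = ((\<lambda>w. bop M w v) ^^ n) u"

definition acts_as_whiskery_cycles :: "'a alg \<Rightarrow> 'a set \<Rightarrow> 'a \<Rightarrow> bool" where
  "acts_as_whiskery_cycles M Q a \<longleftrightarrow>
     (\<forall>q\<in>Q. \<exists>n\<ge>1. bop M q a = right_power M q a (n + 1))"

lemma automatic_algebra_is_algebra:
  assumes "partial_automaton Q S z \<delta>"
  shows "is_algebra (automatic_algebra Q S z \<delta>)"
  using assms
  by (fastforce simp: partial_automaton_def automatic_algebra_def is_algebra_def subuniverse_def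
      ran_def split: option.splits)

lemma ISP_I:
  fixes A :: "'b alg" and M :: "'a alg" and I :: "'i set"
  assumes A: "is_algebra A" and B: "subalgebra B (power_alg M I)" and iso: "isomorphic A B"
  shows "A \<in> ISP M"
proof -
  obtain h where h: "h \<in> homs A B" and bij: "bij_betw h (universe A) (universe B)"
    using iso by (auto simp: isomorphic_def)
  have closed: "bop A x y \<in> universe A" if "x \<in> universe A" "y \<in> universe A" for x y
    using A that by (auto simp: is_algebra_def subuniverse_def)
  have hB: "h x \<in> universe B" if "x \<in> universe A" for x
    using h that by (auto simp: homs_def)
  have hP: "h x \<in> I \<rightarrow>\<^sub>E universe M" if "x \<in> universe A" for x
    using hB[OF that] B by (auto simp: subalgebra_def subuniverse_def power_alg_def)
  have hm: "h (bop A x y) = (\<lambda>i\<in>I. bop M (h x i) (h y i))" if "x \<in> universe A" "y \<in> universe A" for x y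
    using h B hB that by (auto simp: homs_def subalgebra_def power_alg_def)
  define p where "p = (\<lambda>i. \<lambda>x\<in>universe A. h x i)"
  have p: "p i \<in> homs A M" if "i \<in> I" for i
    using hP hm closed that by (auto simp: p_def homs_def)
  define e where "e = (\<lambda>x\<in>universe A. \<lambda>g\<in>homs A M. g x)"
  define C where "C = \<lparr>universe = e ` universe A, bop = bop (power_alg M (homs A M))\<rparr>"
  have inj: "inj_on e (universe A)"
  proof (rule inj_onI)
    fix x y assume xy: "x \<in> universe A" "y \<in> universe A" "e x = e y"
    have "g x = g y" if "g \<in> homs A M" for g
      using xy that by (auto simp: e_def dest: fun_cong[of _ _ g])
    then have "p i x = p i y" if "i \<in> I" for i
      using p[OF that] .
    then have "h x i = h y i" if "i \<in> I" for i
      using that xy by (simp add: p_def)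
    then have "h x = h y" using hP xy by (meson PiE_ext)
    then show "x = y" using bij xy by (auto simp: bij_betw_def inj_on_def)
  qed
  have em: "e (bop A x y) = bop (power_alg M (homs A M)) (e x) (e y)"
    if "x \<in> universe A" "y \<in> universe A" for x y
    using that closed by (auto simp: e_def power_alg_def homs_def)
  have eP: "e x \<in> universe (power_alg M (homs A M))" if "x \<in> universe A" for x
    using that by (auto simp: e_def power_alg_def homs_def)
  have "subalgebra C (power_alg M (homs A M))"
    using A eP em closed
    by (auto simp: subalgebra_def subuniverse_def C_def is_algebra_def simp flip: em)
  moreover have "isomorphic A C"
    unfolding isomorphic_def
    using inj em by (intro bexI[of _ e]) (auto simp: C_def homs_def bij_betw_def e_def)
  ultimately show ?thesis using A by (auto simp: ISP_def)
qed

end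

theory Submission
  imports Defs
begin

text \<open>
  Write \<open>0\<close> for the zero element \<open>z\<close>. Let \<open>r = qa\<close> for a state \<open>q\<close> with \<open>qa \<noteq> qa\<^sup>n\<close> for all \<open>n \<ge> 2\<close>. Then \<open>r\<close> is neither \<open>0\<close> nor \<open>q\<close>,
  so along the orbit \<open>q, qa, qaa, \<dots>\<close> it appears after exactly one step.

  Non-dualizability of an extension \<open>N\<close> of \<open>M\<close> is shown with a ghost element. Suppose that an
  algebra \<open>A\<close> in a power of \<open>N\<close> contains elements \<open>w\<^sub>0, w\<^sub>1, \<dots>\<close> such that each homomorphism
  \<open>h : A \<rightarrow> N\<close> is constant on them with at most \<open>L\<close> exceptions, where \<open>L\<close> does not depend on \<open>h\<close>.
  Mapping \<open>h\<close> to this near-constant value looks like an evaluation: finitely many homomorphisms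
  take their near-constant values at a common \<open>w\<^sub>k\<close>, so compatible relations are preserved, and
  \<open>2L + 1\<close> of the \<open>w\<^sub>k\<close> determine the value, so the map is continuous. On the projections it gives
  the coordinatewise limit of the \<open>w\<^sub>k\<close>, the ghost. If the ghost is missing from \<open>A\<close>, the map is
  no evaluation (\<open>not_dualizable_ghost_power\<close>).

  For the construction, take a vector \<open>x\<^sub>F\<close> with entries in \<open>{q, 0}\<close> and a vector \<open>y\<^sub>G\<close> with entries
  in \<open>{a, 0}\<close> for all finite sets \<open>F, G\<close> of naturals. Their supports are chosen such that
  \<open>x\<^sub>F y\<^sub>G = w\<^sub>i\<close> whenever \<open>F \<inter> G = {i}\<close>, where \<open>w\<^sub>i\<close> has the value \<open>r\<close> at a distinguished coordinate
  and at the coordinate of \<open>i\<close>, and \<open>0\<close> elsewhere. The ghost is \<open>r\<close> at the distinguished coordinate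
  only. It is not generated: since \<open>r\<close> occurs only after one step, it would have to be some
  \<open>x\<^sub>F y\<^sub>G\<close>, but the supports of \<open>x\<^sub>F\<close> and \<open>y\<^sub>G\<close> always meet outside the distinguished coordinate.

  A homomorphism into \<open>N\<close> colours the \<open>y\<^sub>G\<close> with \<open>|N|\<close> colours. If \<open>y\<^sub>G\<close> and \<open>y\<^sub>H\<close> have the same
  colour, then \<open>x\<^sub>F y\<^sub>G\<close> and \<open>x\<^sub>F y\<^sub>H\<close> have the same image, so the images of \<open>w\<^sub>i\<close> and \<open>w\<^sub>j\<close> agree when
  \<open>F \<inter> G = {i}\<close> and \<open>F \<inter> H = {j}\<close>. A pigeonhole argument on two-element sets shows that this forces
  near-constancy with \<open>L = |N|\<close> (\<open>near_constant\<close>).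
\<close>

section \<open>The ghost element method\<close>

text \<open>
  The homomorphisms that agree with a given one on a finite set form an open cylinder, and such
  cylinders make up every fibre.
\<close>

lemma continuous_map_finite_dependence:
  fixes A :: "'b alg" and N :: "'a alg"
  assumes W: "finite W" "W \<subseteq> universe A"
    and f: "\<And>h. h \<in> homs A N \<Longrightarrow> f h \<in> universe N"
    and dep: "\<And>h h'. h \<in> homs A N \<Longrightarrow> h' \<in> homs A N \<Longrightarrow> (\<And>c. c \<in> W \<Longrightarrow> h c = h' c) \<Longrightarrow> f h = f h'"
  shows "continuous_map (hom_topology A N) (discrete_topology (universe N)) f"
proof -
  let ?T = "product_topology (\<lambda>_. discrete_topology (universe N)) (universe A)"
  have homs_sub: "homs A N \<subseteq> universe A \<rightarrow>\<^sub>E universe N"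
    by (auto simp: homs_def)
  then have top: "topspace (hom_topology A N) = homs A N"
    by (auto simp: hom_topology_def)
  have "openin (hom_topology A N) {h \<in> homs A N. f h \<in> U}" for U
  proof -
    define cyl where
      "cyl h = (\<Pi>\<^sub>E c\<in>universe A. if c \<in> W then {h c} else universe N)" for h :: "'b \<Rightarrow> 'a"
    have cyl: "openin ?T (cyl h)" if "h \<in> homs A N" for h
    proof -
      have "finite {c \<in> universe A. (if c \<in> W then {h c} else universe N) \<noteq> universe N}"
        by (rule finite_subset[OF _ W(1)]) auto
      moreover have "h c \<in> universe N" if "c \<in> universe A" for c
        using \<open>h \<in> homs A N\<close> homs_sub that by auto
      ultimately show ?thesis
        unfolding cyl_def by (subst openin_PiE_gen) auto
    qed
    have in_cyl: "h' \<in> cyl h \<longleftrightarrow> (\<forall>c\<in>W. h' c = h c)" if "h' \<in> homs A N" for h h'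
      using that homs_sub W(2) by (force simp: cyl_def PiE_iff)
    have "{h \<in> homs A N. f h \<in> U} = homs A N \<inter> \<Union> (cyl ` {h \<in> homs A N. f h \<in> U})"
      (is "?L = ?R")
    proof (intro equalityI subsetI)
      fix h assume "h \<in> ?L"
      then show "h \<in> ?R" using in_cyl[of h h] by auto
    next
      fix h' assume "h' \<in> ?R"
      then obtain h where h: "h' \<in> homs A N" "h \<in> homs A N" "f h \<in> U" "h' \<in> cyl h" by auto
      then have "f h' = f h" using in_cyl[of h' h] by (intro dep) auto
      with h show "h' \<in> ?L" by simp
    qed
    moreover have "openin ?T (\<Union> (cyl ` {h \<in> homs A N. f h \<in> U}))"
      using cyl by (intro openin_Union) auto
    ultimately show ?thesis
      unfolding hom_topology_def openin_subtopology by (metis Int_commute)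
  qed
  then show ?thesis
    using f by (auto simp: continuous_map_def top)
qed

text \<open>
  The uniform bound \<open>L\<close> is what makes the near-constant value continuous in \<open>h\<close>; finitely many
  exceptions without a bound would only give preservation of the compatible relations.
\<close>

lemma not_dualizable_ghost:
  fixes A :: "'b::infinite alg" and N :: "'a alg" and w :: "nat \<Rightarrow> 'b"
  assumes A: "A \<in> ISP N"
    and w: "\<And>k. w k \<in> universe A"
    and small: "\<And>h. h \<in> homs A N \<Longrightarrow>
      \<exists>v. finite {k. h (w k) \<noteq> v} \<and> card {k. h (w k) \<noteq> v} \<le> L"
    and ghost: "\<And>b. b \<in> universe A \<Longrightarrow> \<exists>h\<in>homs A N. infinite {k. h (w k) \<noteq> h b}"
  shows "\<not> dualizable TYPE('b) N"
proof
  assume dual: "dualizable TYPE('b) N"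
  define f where
    "f h = (SOME v. finite {k. h (w k) \<noteq> v} \<and> card {k. h (w k) \<noteq> v} \<le> L)" for h :: "'b \<Rightarrow> 'a"
  have f: "finite {k. h (w k) \<noteq> f h}" "card {k. h (w k) \<noteq> f h} \<le> L" if "h \<in> homs A N" for h
    using someI_ex[OF small[OF that]] by (auto simp: f_def)
  have f_mem: "f h \<in> universe N" if h: "h \<in> homs A N" for h
  proof -
    obtain k where "h (w k) = f h"
      using ex_new_if_finite[OF infinite_UNIV_nat f(1)[OF h]] by auto
    moreover have "h (w k) \<in> universe N" using h w by (auto simp: homs_def)
    ultimately show ?thesis by simp
  qed
  have "continuous_map (hom_topology A N) (discrete_topology (universe N)) f"
  proof (rule continuous_map_finite_dependence[where W = "w ` {..2 * L}"])
    fix h h' assume h: "h \<in> homs A N" and h': "h' \<in> homs A N"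
      and eq: "\<And>c. c \<in> w ` {..2 * L} \<Longrightarrow> h c = h' c"
    let ?E = "{k. h (w k) \<noteq> f h} \<union> {k. h' (w k) \<noteq> f h'}"
    have "finite ?E" using f(1) h h' by auto
    have "card ?E \<le> 2 * L"
      using card_Un_le[of "{k. h (w k) \<noteq> f h}" "{k. h' (w k) \<noteq> f h'}"] f(2)[OF h] f(2)[OF h'] by simp
    then have "\<not> {..2 * L} \<subseteq> ?E"
      using card_mono[OF \<open>finite ?E\<close>, of "{..2 * L}"] by auto
    then obtain k where "k \<le> 2 * L" "h (w k) = f h" "h' (w k) = f h'" by auto
    then show "f h = f h'" using eq[of "w k"] by auto
  qed (use w f_mem in auto)
  moreover have "preserves A N f k R" if "compatible_relation N k R" for k R
    unfolding preserves_def
  proof (intro allI impI)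
    fix x assume x: "(\<forall>i<k. x i \<in> homs A N) \<and> (\<forall>a\<in>universe A. (\<lambda>i\<in>{..<k}. x i a) \<in> R)"
    have "finite (\<Union>i<k. {j. x i (w j) \<noteq> f (x i)})" using f(1) x by auto
    then obtain j where "j \<notin> (\<Union>i<k. {j. x i (w j) \<noteq> f (x i)})"
      using ex_new_if_finite[OF infinite_UNIV_nat] by blast
    then have "(\<lambda>i\<in>{..<k}. f (x i)) = (\<lambda>i\<in>{..<k}. x i (w j))" by (intro restrict_ext) auto
    then show "(\<lambda>i\<in>{..<k}. f (x i)) \<in> R" using x w by auto
  qed
  ultimately obtain b where "b \<in> universe A" "\<forall>h\<in>homs A N. f h = h b"
    using dual A unfolding dualizable_def is_evaluation_def by blast
  then show False using ghost[of b] f(1) by force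
qed

text \<open>
  A countable algebra has a copy over any infinite type. In a power, the projections already
  tell the coordinatewise limit of the \<open>w\<^sub>k\<close> from each element of the algebra.
\<close>

lemma not_dualizable_ghost_power:
  fixes B :: "('i \<Rightarrow> 'a) alg" and N :: "'a alg" and w :: "nat \<Rightarrow> 'i \<Rightarrow> 'a"
  assumes B: "subalgebra B (power_alg N I)" and count: "countable (universe B)"
    and w: "\<And>k. w k \<in> universe B"
    and small: "\<And>h. h \<in> homs B N \<Longrightarrow>
      \<exists>v. finite {k. h (w k) \<noteq> v} \<and> card {k. h (w k) \<noteq> v} \<le> L"
    and ghost: "\<And>b. b \<in> universe B \<Longrightarrow> \<exists>i\<in>I. infinite {k. w k i \<noteq> b i}"
  shows "\<not> dualizable TYPE('b::infinite) N"
proof -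
  obtain c0 :: "nat \<Rightarrow> 'b" where c0: "inj c0"
    using infinite_countable_subset[OF infinite_UNIV] by blast
  define c where "c = c0 \<circ> to_nat_on (universe B)"
  have inj: "inj_on c (universe B)"
    unfolding c_def by (intro comp_inj_on inj_on_to_nat_on count inj_on_subset[OF c0]) auto
  define d where "d = inv_into (universe B) c"
  have dc: "d (c x) = x" if "x \<in> universe B" for x
    using that inj by (simp add: d_def)
  define A where "A = \<lparr>universe = c ` universe B, bop = (\<lambda>x y. c (bop B (d x) (d y)))\<rparr>"
  have closed: "bop B x y \<in> universe B" if "x \<in> universe B" "y \<in> universe B" for x y
    using B that by (auto simp: subalgebra_def subuniverse_def)
  have ne: "universe B \<noteq> {}" using B by (simp add: subalgebra_def)
  have algA: "is_algebra A"
    using ne closed by (auto simp: A_def is_algebra_def subuniverse_def dc)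
  have d_hom: "(\<lambda>x\<in>universe A. d x) \<in> homs A B"
    using closed by (auto simp: homs_def A_def dc)
  moreover have "bij_betw (\<lambda>x\<in>universe A. d x) (universe A) (universe B)"
    unfolding bij_betw_def by (auto simp: A_def inj_on_def dc image_iff)
  ultimately have "isomorphic A B" unfolding isomorphic_def by blast
  then have ISP: "A \<in> ISP N" using ISP_I algA B by blast
  have Bpow: "x \<in> I \<rightarrow>\<^sub>E universe N" if "x \<in> universe B" for x
    using B that by (auto simp: subalgebra_def subuniverse_def power_alg_def)
  show ?thesis
  proof (rule not_dualizable_ghost[where A = A and w = "\<lambda>k. c (w k)" and L = L])
    fix h assume h: "h \<in> homs A N"
    have "(\<lambda>x\<in>universe B. h (c x)) \<in> homs B N"
      using h closed by (auto simp: homs_def A_def dc)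
    from small[OF this] show "\<exists>v. finite {k. h (c (w k)) \<noteq> v} \<and> card {k. h (c (w k)) \<noteq> v} \<le> L"
      using w by simp
  next
    fix b assume b: "b \<in> universe A"
    then have db: "d b \<in> universe B" by (auto simp: A_def dc)
    from ghost[OF db] obtain i where i: "i \<in> I" "infinite {k. w k i \<noteq> d b i}" by blast
    let ?p = "\<lambda>x\<in>universe A. d x i"
    have "?p \<in> homs A N"
    proof -
      have mul: "bop B x y i = bop N (x i) (y i)" if "x \<in> universe B" "y \<in> universe B" for x y
        using B that i(1) by (auto simp: subalgebra_def power_alg_def)
      show ?thesis using mul closed Bpow i(1) by (fastforce simp: homs_def A_def dc)
    qed
    moreover have "infinite {k. ?p (c (w k)) \<noteq> ?p b}"
      using i(2) b w by (simp add: A_def dc)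
    ultimately show "\<exists>h\<in>homs A N. infinite {k. h (c (w k)) \<noteq> h b}" by blast
  qed (use ISP w in \<open>auto simp: A_def\<close>)
qed

section \<open>A pigeonhole argument for colourings of finite sets\<close>

text \<open>
  Let \<open>v\<close> be a value that \<open>g\<close> takes infinitely often, and suppose that \<open>g\<close> avoids \<open>v\<close> on a set \<open>D\<close>
  with more elements than there are colours. Each \<open>b\<close> with \<open>g b = v\<close> has distinct \<open>d, d' \<in> D\<close> for
  which \<open>{d, b}\<close> and \<open>{d', b}\<close> have the same colour. Only finitely many triples of \<open>d\<close>, \<open>d'\<close> and
  this colour exist, so some \<open>b \<noteq> b'\<close> share theirs. Then the outer edges of the path
  \<open>b' - d - b - d'\<close> have the same colour and meet its middle edge \<open>F = {d, b}\<close> in \<open>{d}\<close> and \<open>{b}\<close>,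
  whence \<open>g d = g b = v\<close>.
\<close>

lemma near_constant:
  fixes c :: "nat set \<Rightarrow> 'c" and g :: "nat \<Rightarrow> 'c"
  assumes C: "finite C" "\<And>G. finite G \<Longrightarrow> c G \<in> C" "\<And>k. g k \<in> C"
    and eq: "\<And>F G H i j. finite F \<Longrightarrow> finite G \<Longrightarrow> finite H \<Longrightarrow> F \<inter> G = {i} \<Longrightarrow> F \<inter> H = {j} \<Longrightarrow>
      c G = c H \<Longrightarrow> g i = g j"
  shows "\<exists>v. finite {k. g k \<noteq> v} \<and> card {k. g k \<noteq> v} \<le> card C"
proof -
  have "finite (range g)" using C by (auto intro: finite_subset)
  then obtain v where inf: "infinite {k. g k = v}"
    using pigeonhole_infinite[OF infinite_UNIV_nat] by auto
  show ?thesis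
  proof (rule ccontr)
    assume "\<not> ?thesis"
    then have "infinite {k. g k \<noteq> v} \<or> card {k. g k \<noteq> v} \<ge> Suc (card C)" by (meson not_less_eq_eq)
    then obtain D where D: "finite D" "D \<subseteq> {k. g k \<noteq> v}" "card D = Suc (card C)"
      using infinite_arbitrarily_large obtain_subset_with_card_n by metis
    have "\<exists>d d'. d \<in> D \<and> d' \<in> D \<and> d \<noteq> d' \<and> c {d, b} = c {d', b}" for b
    proof -
      have "card ((\<lambda>d. c {d, b}) ` D) \<le> card C" using C by (intro card_mono) auto
      then have "\<not> inj_on (\<lambda>d. c {d, b}) D" using D(3) pigeonhole[of "\<lambda>d. c {d, b}" D] by linarith
      then show ?thesis by (auto simp: inj_on_def)
    qed
    then obtain d d' where d: "\<And>b. d b \<in> D \<and> d' b \<in> D \<and> d b \<noteq> d' b \<and> c {d b, b} = c {d' b, b}"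
      by metis
    let ?t = "\<lambda>b. (d b, d' b, c {d b, b})"
    have "?t ` {k. g k = v} \<subseteq> D \<times> D \<times> C" using d C by auto
    then have "finite (?t ` {k. g k = v})" using D C by (meson finite_SigmaI finite_subset)
    then obtain b where b: "g b = v" and "infinite {b' \<in> {k. g k = v}. ?t b' = ?t b}"
      using pigeonhole_infinite[OF inf] by blast
    then obtain b' where b': "b' \<in> {b' \<in> {k. g k = v}. ?t b' = ?t b}" "b' \<noteq> b"
      by (metis (no_types, lifting) finite.emptyI finite_insert insertCI finite_subset subsetI)
    have ne: "d b \<noteq> b" "d b \<noteq> b'" "d' b \<noteq> b" using d[of b] D(2) b b' by auto
    have "g (d b) = g b"
    proof (rule eq[of "{d b, b}" "{d b, b'}" "{d' b, b}"])
      show "c {d b, b'} = c {d' b, b}" using b' d[of b] by auto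
    qed (use ne b' d[of b] in auto)
    then show False using d[of b] D(2) b by auto
  qed
qed

section \<open>Supports of the generating vectors\<close>

text \<open>
  \<open>Whole\<close> lies in all supports, and \<open>Point i\<close> distinguishes the elements \<open>w\<^sub>i\<close> from their limit. If
  \<open>F\<close> and \<open>G\<close> are disjoint, no \<open>Point\<close> lies in the supports of both \<open>x\<^sub>F\<close> and \<open>y\<^sub>G\<close>; then they share
  the coordinate \<open>Apart F\<close>, which keeps \<open>x\<^sub>F y\<^sub>G\<close> different from the ghost.
\<close>

datatype coord = Whole | Point nat | Apart "nat set"

definition state_support :: "nat set \<Rightarrow> coord set" where
  "state_support F = {Whole, Apart F} \<union> Point ` F"

definition letter_support :: "nat set \<Rightarrow> coord set" where
  "letter_support G = {Whole} \<union> Point ` G \<union> {Apart F | F. F \<inter> G = {}}"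

lemma support_singleton:
  assumes "F \<inter> G = {i}"
  shows "state_support F \<inter> letter_support G = {Whole, Point i}"
  using assms by (auto simp: state_support_def letter_support_def)

lemma support_meet: "\<exists>p. p \<noteq> Whole \<and> p \<in> state_support F \<inter> letter_support G"
proof (cases "F \<inter> G = {}")
  case True
  then show ?thesis by (intro exI[of _ "Apart F"]) (auto simp: state_support_def letter_support_def)
next
  case False
  then obtain i where "i \<in> F" "i \<in> G" by blast
  then show ?thesis by (intro exI[of _ "Point i"]) (auto simp: state_support_def letter_support_def)
qed

section \<open>An algebra without its ghost\<close>

locale non_whiskery_state =
  fixes Q S :: "'a set" and z :: 'a and \<delta> :: "'a \<Rightarrow> 'a \<rightharpoonup> 'a" and a q :: 'a
  assumes automaton: "partial_automaton Q S z \<delta>"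
    and letter: "a \<in> S" and state: "q \<in> Q"
    and not_whiskery: "\<And>n. n \<ge> 1 \<Longrightarrow>
      bop (automatic_algebra Q S z \<delta>) q a \<noteq> right_power (automatic_algebra Q S z \<delta>) q a (n + 1)"
begin

abbreviation "M \<equiv> automatic_algebra Q S z \<delta>"

definition orbit :: "nat \<Rightarrow> 'a" where "orbit n = right_power M q a n"

lemma orbit_0: "orbit 0 = q" and orbit_Suc: "orbit (Suc n) = bop M (orbit n) a"
  by (simp_all add: orbit_def right_power_def)

lemma mul_z: "bop M z u = z" "bop M u z = z"
  using automaton by (auto simp: automatic_algebra_def partial_automaton_def)

lemma mul_state: "u \<in> Q \<union> {z} \<Longrightarrow> bop M v u = z"
  using automaton by (auto simp: automatic_algebra_def partial_automaton_def)

lemma mul_letter: "bop M a u = z"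
  using automaton letter by (auto simp: automatic_algebra_def partial_automaton_def)

lemma orbit_mem: "orbit n \<in> Q \<union> {z}"
proof (induction n)
  case 0
  then show ?case using state by (simp add: orbit_0)
next
  case (Suc n)
  then show ?case using automaton letter
    by (fastforce simp: orbit_Suc automatic_algebra_def partial_automaton_def ran_def
        split: option.splits)
qed

text \<open>
  For \<open>n = 0\<close>: if \<open>q = qa\<close> then also \<open>qa = qaa\<close>, so this case reduces to \<open>n = 2\<close>.
\<close>

lemma orbit_ne:
  assumes "n \<noteq> 1" shows "orbit n \<noteq> orbit 1"
proof -
  have ge2: "orbit (k + 1) \<noteq> orbit 1" if "k \<ge> 1" for k
  proof -
    have "orbit 1 = bop M q a" using orbit_Suc[of 0] by (simp add: orbit_0)
    then show ?thesis using not_whiskery[OF that] by (simp add: orbit_def)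
  qed
  consider "n = 0" | "n \<ge> 2" using assms by linarith
  then show ?thesis
  proof cases
    case 1
    then show ?thesis using ge2[of 1] orbit_Suc[of 0] orbit_Suc[of 1] by auto
  next
    case 2
    then show ?thesis using ge2[of "n - 1"] by simp
  qed
qed

text \<open>If \<open>qa\<close> were \<open>0\<close>, then \<open>qaa\<close> would be \<open>0\<close> as well.\<close>

lemma orbit_1_ne_z: "orbit 1 \<noteq> z"
  using orbit_ne[of 2] orbit_Suc[of 1] mul_z by (auto simp: numeral_2_eq_2)

lemma a_ne_orbit: "a \<noteq> orbit n"
  using orbit_mem[of n] automaton letter by (auto simp: partial_automaton_def)

definition on :: "'a \<Rightarrow> coord set \<Rightarrow> coord \<Rightarrow> 'a" where
  "on u U p = (if p \<in> U then u else z)"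

text \<open>
  In closed form, this is the product of \<open>x\<^sub>F\<close> with the vectors \<open>y\<^sub>G\<close> for \<open>G\<close> in the list \<open>Gs\<close>,
  bracketed from the left.
\<close>

definition state_vec :: "nat set \<Rightarrow> nat set list \<Rightarrow> coord \<Rightarrow> 'a" where
  "state_vec F Gs = on (orbit (length Gs)) (state_support F \<inter> (\<Inter>G\<in>set Gs. letter_support G))"

definition letter_vec :: "nat set \<Rightarrow> coord \<Rightarrow> 'a" where
  "letter_vec G = on a (letter_support G)"

text \<open>
  The generated subalgebra of the power is described explicitly here. All products other than
  those with the form of \<open>state_vec F Gs\<close> vanish, because only letters act and they act only on
  states.
\<close>

definition ghostly :: "(coord \<Rightarrow> 'a) alg" where
  "ghostly = \<lparr>universe = {on z {}} \<union> letter_vec ` Collect finite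
           \<union> (\<lambda>(F, Gs). state_vec F Gs) ` (Collect finite \<times> lists (Collect finite)),
        bop = (\<lambda>x y p. bop M (x p) (y p))\<rparr>"

lemma ghostly_cases:
  assumes "x \<in> universe ghostly"
  obtains "x = on z {}" | G where "finite G" "x = letter_vec G"
    | F Gs where "finite F" "\<forall>G\<in>set Gs. finite G" "x = state_vec F Gs"
  using assms by (auto simp: ghostly_def)

lemma zero_in_ghostly: "on z {} \<in> universe ghostly"
  and letter_vec_in_ghostly: "finite G \<Longrightarrow> letter_vec G \<in> universe ghostly"
  and state_vec_in_ghostly: "finite F \<Longrightarrow> \<forall>G\<in>set Gs. finite G \<Longrightarrow> state_vec F Gs \<in> universe ghostly"
  by (auto simp: ghostly_def)

lemma state_vec_letter_vec: "bop ghostly (state_vec F Gs) (letter_vec G) = state_vec F (Gs @ [G])"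
  by (auto simp: ghostly_def state_vec_def letter_vec_def on_def orbit_Suc mul_z)

lemma mul_state_vec: "bop ghostly x (state_vec F Gs) = on z {}"
  using orbit_mem by (auto simp: ghostly_def state_vec_def on_def mul_state mul_z)

lemma mul_zero: "bop ghostly x (on z {}) = on z {}" "bop ghostly (on z {}) x = on z {}"
  by (auto simp: ghostly_def on_def mul_z)

lemma letter_vec_mul: "bop ghostly (letter_vec G) x = on z {}"
  by (auto simp: ghostly_def letter_vec_def on_def mul_z mul_letter)

lemma ghostly_closed:
  assumes x: "x \<in> universe ghostly" and y: "y \<in> universe ghostly"
  shows "bop ghostly x y \<in> universe ghostly"
  using y
proof (cases rule: ghostly_cases)
  case (2 G)
  from x show ?thesis
  proof (cases rule: ghostly_cases)
    case (3 F Gs)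
    then show ?thesis using 2 by (simp add: state_vec_letter_vec state_vec_in_ghostly)
  qed (simp_all add: mul_zero letter_vec_mul zero_in_ghostly)
qed (simp_all add: mul_zero mul_state_vec zero_in_ghostly)

lemma ghostly_subalgebra:
  assumes "subalgebra M N"
  shows "subalgebra ghostly (power_alg N UNIV)"
proof -
  have M_mem: "x p \<in> universe M" if "x \<in> universe ghostly" for x p
    using that
  proof (cases rule: ghostly_cases)
    case (3 F Gs)
    then show ?thesis using orbit_mem[of "length Gs"] by (auto simp: state_vec_def on_def automatic_algebra_def)
  qed (use letter in \<open>auto simp: letter_vec_def on_def automatic_algebra_def\<close>)
  have bop: "bop ghostly x y = bop (power_alg N UNIV) x y" if "x \<in> universe ghostly" "y \<in> universe ghostly" for x y
    using that M_mem assms by (auto simp: ghostly_def power_alg_def subalgebra_def)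
  have "x \<in> UNIV \<rightarrow>\<^sub>E universe N" if "x \<in> universe ghostly" for x
    using that M_mem assms by (auto simp: subalgebra_def subuniverse_def)
  then show ?thesis
    using bop ghostly_closed zero_in_ghostly
    by (auto simp: subalgebra_def subuniverse_def power_alg_def simp flip: bop)
qed

lemma ghostly_countable: "countable (universe ghostly)"
proof -
  have "countable (Collect finite :: nat set set)" by (rule countable_Collect_finite)
  then show ?thesis by (auto simp: ghostly_def intro!: countable_SIGMA countable_lists)
qed

definition converging :: "nat \<Rightarrow> coord \<Rightarrow> 'a" where
  "converging i = on (orbit 1) {Whole, Point i}"

lemma mul_converging: "F \<inter> G = {i} \<Longrightarrow> bop ghostly (state_vec F []) (letter_vec G) = converging i"
  using state_vec_letter_vec[of F "[]" G]
  by (simp add: state_vec_def converging_def support_singleton)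

lemma converging_in_ghostly: "converging i \<in> universe ghostly"
proof -
  have "bop ghostly (state_vec {i} []) (letter_vec {i}) = converging i" by (simp add: mul_converging)
  then show ?thesis by (metis ghostly_closed state_vec_in_ghostly letter_vec_in_ghostly empty_iff empty_set finite.simps)
qed

text \<open>
  Products with exactly one letter vector are excluded by a second coordinate in their support;
  all other elements do not have the value \<open>qa\<close> at \<open>Whole\<close>.
\<close>

lemma ghost_not_in_ghostly:
  assumes "b \<in> universe ghostly"
  shows "b \<noteq> on (orbit 1) {Whole}"
  using assms
proof (cases rule: ghostly_cases)
  case 1
  then show ?thesis using orbit_1_ne_z by (auto simp: on_def fun_eq_iff)
next
  case (2 G)
  then show ?thesis using a_ne_orbit[of 1]
    by (auto simp: letter_vec_def letter_support_def on_def fun_eq_iff intro!: exI[of _ Whole])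
next
  case (3 F Gs)
  show ?thesis
  proof (cases "length Gs = 1")
    case True
    then obtain G where G: "Gs = [G]" by (auto simp: length_Suc_conv)
    obtain p where "p \<noteq> Whole" "p \<in> state_support F \<inter> letter_support G"
      using support_meet by blast
    then show ?thesis using 3 G orbit_1_ne_z
      by (auto simp: state_vec_def on_def fun_eq_iff intro!: exI[of _ p])
  next
    case False
    have "b Whole = orbit (length Gs)"
      using 3 by (auto simp: state_vec_def on_def state_support_def letter_support_def)
    then show ?thesis using orbit_ne[OF False] by (auto simp: on_def)
  qed
qed

lemma not_dualizable_extension:
  assumes N: "finite (universe N)" "subalgebra M N"
  shows "\<not> dualizable TYPE('b::infinite) N"
proof (rule not_dualizable_ghost_power[where B = ghostly and w = converging])
  show "subalgebra ghostly (power_alg N UNIV)" using N(2) by (rule ghostly_subalgebra)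
  show "countable (universe ghostly)" by (rule ghostly_countable)
  show "converging k \<in> universe ghostly" for k by (rule converging_in_ghostly)
  show "\<exists>v. finite {k. h (converging k) \<noteq> v} \<and> card {k. h (converging k) \<noteq> v} \<le> card (universe N)"
    if h: "h \<in> homs ghostly N" for h
  proof (rule near_constant[where c = "\<lambda>G. h (letter_vec G)"])
    have mem: "h x \<in> universe N" if "x \<in> universe ghostly" for x using h that by (auto simp: homs_def)
    show "finite (universe N)" by fact
    show "h (letter_vec G) \<in> universe N" if "finite G" for G using mem letter_vec_in_ghostly that by blast
    show "h (converging k) \<in> universe N" for k using mem converging_in_ghostly by blast
    fix F G H i j
    assume FGH: "finite F" "finite G" "finite H" "F \<inter> G = {i}" "F \<inter> H = {j}"
      and eq: "h (letter_vec G) = h (letter_vec H)"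
    have "h (converging k) = bop N (h (state_vec F [])) (h (letter_vec G'))"
      if "finite G'" "F \<inter> G' = {k}" for G' k
      using h FGH(1) that letter_vec_in_ghostly state_vec_in_ghostly[of F "[]"]
      by (auto simp: homs_def simp flip: mul_converging[OF that(2)])
    then show "h (converging i) = h (converging j)" using FGH eq by metis
  qed
  fix b assume b: "b \<in> universe ghostly"
  show "\<exists>p\<in>UNIV. infinite {k. converging k p \<noteq> b p}"
  proof (rule ccontr)
    assume "\<not> ?thesis"
    then have fin: "finite {k. converging k p \<noteq> b p}" for p by auto
    \<comment> \<open>At each coordinate, all but at most one of the vectors \<open>converging k\<close> have the value of the ghost.\<close>
    have "b p = on (orbit 1) {Whole} p" for p
    proof -
      have "finite ({k. converging k p \<noteq> b p} \<union> {k. p = Point k})"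
        using fin by (cases p) auto
      then obtain k where "converging k p = b p" "p \<noteq> Point k"
        using ex_new_if_finite[OF infinite_UNIV_nat] by blast
      then show ?thesis by (auto simp: converging_def on_def)
    qed
    then show False using ghost_not_in_ghostly[OF b] by blast
  qed
qed

end

theorem theorem2p5:
  fixes Q S :: "'a::infinite set" and z a :: 'a and \<delta> :: "'a \<Rightarrow> 'a \<rightharpoonup> 'a"
  assumes "partial_automaton Q S z \<delta>"
    and "finite Q" and "finite S"
    and "a \<in> S"
    and "\<not> acts_as_whiskery_cycles (automatic_algebra Q S z \<delta>) Q a"
  shows "inherently_nondualizable TYPE('b::infinite) (automatic_algebra Q S z \<delta>)"
proof -
  obtain q where q: "non_whiskery_state Q S z \<delta> a q"
    using assms by (auto simp: acts_as_whiskery_cycles_def non_whiskery_state_def)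
  show ?thesis
    unfolding inherently_nondualizable_def
    using non_whiskery_state.not_dualizable_extension[OF q] by auto
qed

end
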